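(* Let $\rho,\kappa,\delta>0$ and $0<\alpha<1$, and let $$\omega(\xi)=\left(\frac{2\kappa}{\rho\,\delta^{2\alpha}}\int_{-1}^{1}\frac{1-\cos(\xi\delta z)}{|z|^{1+2\alpha}}\,dz\right)^{1/2},\qquad \xi\in\mathbb R.$$ Then $$\lim_{\xi\to0}\xi^{-2}\omega^2(\xi)=\frac{\kappa\,\delta^{2(1-\alpha)}}{(1-\alpha)\rho}$$ and $$\lim_{\xi\to\pm\infty}|\xi|^{-2\alpha}\omega^2(\xi)=\frac{4\kappa}{\rho}\int_0^{+\infty}\frac{1-\cos\tau}{\tau^{1+2\alpha}}\,d\tau.$$ *)

theory Defs
  imports "HOL-Analysis.Analysis"
begin

text \<open>
  The integrand is nonnegative, and its value at \<open>z = 0\<close> is \<open>0\<close> by totality of division,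
  which is irrelevant for the Lebesgue integral.
\<close>
definition omega :: "real \<Rightarrow> real \<Rightarrow> real \<Rightarrow> real \<Rightarrow> real \<Rightarrow> real" where
  "omega \<rho> \<kappa> \<delta> \<alpha> \<xi> =
     sqrt (2 * \<kappa> / (\<rho> * \<delta> powr (2 * \<alpha>)) *
       (LBINT z:{-1..1}. (1 - cos (\<xi> * \<delta> * z)) / \<bar>z\<bar> powr (1 + 2 * \<alpha>)))"

end

theory Submission
  imports Defs "HOL-Real_Asymp.Real_Asymp"
begin

text \<open>
  Up to the factor \<open>2 * \<kappa> / (\<rho> * \<delta> powr (2 * \<alpha>))\<close>, the square of the dispersion relation is
  \<open>kernel_integral \<alpha> (\<xi> * \<delta>)\<close>, where \<open>kernel_integral \<alpha> \<mu>\<close> is the integral of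
  \<open>(1 - cos (\<mu> * z)) / \<bar>z\<bar> powr (1 + 2 * \<alpha>)\<close> over \<open>[-1, 1]\<close>. The integrand is even in \<open>z\<close>, so this
  is twice the integral over \<open>[0, 1]\<close>, and everything rests on the two-sided control
  \<open>0 \<le> 1 - cos x \<le> min (x\<^sup>2 / 2) 2\<close>: the quadratic bound tames the singularity at \<open>0\<close> because
  \<open>\<alpha> < 1\<close>, the constant one makes the kernel integrable at infinity because \<open>\<alpha> > 0\<close>.

  For low frequencies (\<open>kernel_integral_at_0\<close>), the integrand divided by \<open>\<mu>\<^sup>2\<close> tends to
  \<open>z powr (1 - 2 * \<alpha>) / 2\<close> and is dominated by that same limit, whose integral over \<open>[0, 1]\<close> is
  \<open>1 / (4 * (1 - \<alpha>))\<close>.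

  For high frequencies (\<open>kernel_integral_at_top\<close>), the kernel is homogeneous: the substitution
  \<open>\<tau> = \<mu> * z\<close> (\<open>kernel_integral_rescale\<close>) extracts the factor \<open>\<mu> powr (2 * \<alpha>)\<close> and moves the
  frequency into the upper limit of integration, so that what remains is a truncation of the
  convergent integral over the half-line. The limit at \<open>-\<infinity>\<close> follows since \<open>\<omega>\<close> is even.
\<close>

section \<open>Lebesgue integrals on the line\<close>

text \<open>
  The antiderivatives of powers yield improper Henstock--Kurzweil integrals. For nonnegative Borel
  functions such an integral converges absolutely, so its value is that of the Lebesgue integral.
\<close>
lemma set_integrable_lborel_if_nonneg_has_integral:
  fixes f :: "real \<Rightarrow> real"
  assumes int: "(f has_integral I) S" and [measurable]: "S \<in> sets borel" "f \<in> borel_measurable borel"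
    and nonneg: "\<And>x. x \<in> S \<Longrightarrow> 0 \<le> f x"
  shows "set_integrable lborel S f" and "(LBINT x:S. f x) = I"
proof -
  have "set_integrable lebesgue S f"
    using int nonneg by (intro nonnegative_absolutely_integrable_1) (auto simp: integrable_on_def)
  then show *: "set_integrable lborel S f"
    unfolding set_integrable_def by (subst (asm) integrable_completion) auto
  show "(LBINT x:S. f x) = I"
    using set_borel_integral_eq_integral(2)[OF *] int by (simp add: integral_unique)
qed

lemma set_integral_symmetric_interval_even:
  fixes f :: "real \<Rightarrow> real"
  assumes even: "\<And>x. f (- x) = f x" and int: "set_integrable lborel {0..a} f" and "0 \<le> a"
  shows "(LBINT x:{-a..a}. f x) = 2 * (LBINT x:{0..a}. f x)"
proof -
  have "integrable lborel (\<lambda>x. indicator {0..a} (0 + (-1) * x) *\<^sub>R f (0 + (-1) * x))"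
    using int unfolding set_integrable_def by (rule lborel_integrable_real_affine) simp
  also have "(\<lambda>x. indicator {0..a} (0 + (-1) * x) *\<^sub>R f (0 + (-1) * x))
      = (\<lambda>x. indicator {-a..0} x *\<^sub>R f x)"
    by (auto simp: even indicator_def fun_eq_iff)
  finally have int': "set_integrable lborel {-a..0} f"
    unfolding set_integrable_def .
  have reflect: "(LBINT x:{-a..0}. f x) = (LBINT x:{0..a}. f x)"
  proof (subst set_integral_reflect, unfold even)
    have "{x. - x \<in> {-a..0}} = {0..a}" by auto
    then show "(LBINT x:{x. - x \<in> {-a..0}}. f x) = (LBINT x:{0..a}. f x)" by simp
  qed
  have "{-a..a} = {-a..0} \<union> {0..a}" using \<open>0 \<le> a\<close> by auto
  moreover have "AE x in lborel. \<not> (x \<in> {-a..0} \<and> x \<in> {0..a})"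
    using AE_lborel_singleton[of "0::real"] by eventually_elim auto
  ultimately have "(LBINT x:{-a..a}. f x) = (LBINT x:{-a..0}. f x) + (LBINT x:{0..a}. f x)"
    using int int' by (simp add: set_integral_Un_AE)
  with reflect show ?thesis by simp
qed

section \<open>The singular kernel\<close>

lemma one_minus_cos_le: "1 - cos x \<le> x\<^sup>2 / 2" for x :: real
proof -
  have "1 - cos x = 2 * (sin (x / 2))\<^sup>2"
    using cos_double_sin[of "x / 2"] by simp
  also have "(sin (x / 2))\<^sup>2 \<le> (x / 2)\<^sup>2"
    using abs_sin_x_le_abs_x[of "x / 2"] by (rule abs_le_square_iff[THEN iffD1])
  finally show ?thesis by (simp add: power_divide)
qed

lemma square_div_powr: "z\<^sup>2 / z powr (1 + 2 * \<alpha>) = z powr (1 - 2 * \<alpha>)"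
  if "0 \<le> z" for z \<alpha> :: real
proof (cases "z = 0")
  case False
  with that have "z\<^sup>2 = z powr 2" by simp
  then show ?thesis by (simp flip: powr_diff)
qed simp

text \<open>
  The cancellation of \<open>1 - cos\<close> at \<open>0\<close> lowers the order of the singularity by two. This bound is
  both the reason for integrability near \<open>0\<close> and, being exactly quadratic in \<open>\<mu>\<close>, the dominating
  function of the low-frequency limit.
\<close>
lemma kernel_le:
  fixes z \<alpha> \<mu> :: real
  assumes "0 \<le> z"
  shows "\<bar>(1 - cos (\<mu> * z)) / z powr (1 + 2 * \<alpha>)\<bar> \<le> \<mu>\<^sup>2 / 2 * z powr (1 - 2 * \<alpha>)"
proof -
  have "\<bar>(1 - cos (\<mu> * z)) / z powr (1 + 2 * \<alpha>)\<bar> = (1 - cos (\<mu> * z)) / z powr (1 + 2 * \<alpha>)"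
    by simp
  also have "\<dots> \<le> (\<mu> * z)\<^sup>2 / 2 / z powr (1 + 2 * \<alpha>)"
    by (intro divide_right_mono one_minus_cos_le) simp
  also have "\<dots> = \<mu>\<^sup>2 / 2 * (z\<^sup>2 / z powr (1 + 2 * \<alpha>))"
    by (simp add: power_mult_distrib)
  finally show ?thesis using square_div_powr[OF assms] by simp
qed

lemma
  fixes \<alpha> :: real
  assumes "\<alpha> < 1"
  shows set_integrable_powr_unit: "set_integrable lborel {0..1} (\<lambda>z. z powr (1 - 2 * \<alpha>))"
    and set_integral_powr_unit: "(LBINT z:{0..1}. z powr (1 - 2 * \<alpha>)) = 1 / (2 * (1 - \<alpha>))"
proof -
  have "((\<lambda>z. z powr (1 - 2 * \<alpha>)) has_integral (1 / (2 * (1 - \<alpha>)))) {0..1}"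
    using has_integral_powr_from_0[of "1 - 2 * \<alpha>" 1] assms by (simp add: algebra_simps)
  from set_integrable_lborel_if_nonneg_has_integral[OF this]
  show "set_integrable lborel {0..1} (\<lambda>z. z powr (1 - 2 * \<alpha>))"
    and "(LBINT z:{0..1}. z powr (1 - 2 * \<alpha>)) = 1 / (2 * (1 - \<alpha>))"
    by simp_all
qed

lemma set_integrable_kernel_unit:
  fixes \<alpha> \<mu> :: real
  assumes "\<alpha> < 1"
  shows "set_integrable lborel {0..1} (\<lambda>z. (1 - cos (\<mu> * z)) / z powr (1 + 2 * \<alpha>))"
proof (rule set_integrable_bound)
  show "set_integrable lborel {0..1} (\<lambda>z. \<mu>\<^sup>2 / 2 * z powr (1 - 2 * \<alpha>))"
    using set_integrable_powr_unit[OF assms] by simp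
  show "AE z in lborel. z \<in> {0..1} \<longrightarrow>
      norm ((1 - cos (\<mu> * z)) / z powr (1 + 2 * \<alpha>)) \<le> norm (\<mu>\<^sup>2 / 2 * z powr (1 - 2 * \<alpha>))"
    using kernel_le by (auto intro!: always_eventually order_trans[OF _ abs_ge_self])
qed (simp add: set_borel_measurable_def)

lemma set_integrable_kernel_half_line:
  fixes \<alpha> :: real
  assumes "0 < \<alpha>" "\<alpha> < 1"
  shows "set_integrable lborel {0..} (\<lambda>\<tau>. (1 - cos \<tau>) / \<tau> powr (1 + 2 * \<alpha>))" (is "set_integrable _ _ ?f")
proof -
  (* At infinity the numerator does not decay, but it is at most 2 and 1 + 2 * \<alpha> > 1. *)
  have tail: "set_integrable lborel {1..} ?f"
  proof (rule set_integrable_bound)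
    have "((\<lambda>x. x powr (- (1 + 2 * \<alpha>))) has_integral
        - (1 powr (- (1 + 2 * \<alpha>) + 1)) / (- (1 + 2 * \<alpha>) + 1)) {1::real..}"
      using assms by (intro has_integral_powr_to_inf) auto
    from set_integrable_lborel_if_nonneg_has_integral(1)[OF this]
    have "set_integrable lborel {1..} (\<lambda>x. x powr (- (1 + 2 * \<alpha>)))" by simp
    then show "set_integrable lborel {1..} (\<lambda>x. 2 * x powr (- (1 + 2 * \<alpha>)))" by simp
    have "\<bar>?f x\<bar> \<le> 2 * x powr (- (1 + 2 * \<alpha>))" for x
    proof -
      have "\<bar>?f x\<bar> = (1 - cos x) / x powr (1 + 2 * \<alpha>)" by simp
      also have "\<dots> \<le> 2 / x powr (1 + 2 * \<alpha>)"
        using cos_ge_minus_one[of x] by (intro divide_right_mono) auto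
      finally show ?thesis by (simp only: powr_minus divide_inverse)
    qed
    then show "AE x in lborel. x \<in> {1..} \<longrightarrow> norm (?f x) \<le> norm (2 * x powr (- (1 + 2 * \<alpha>)))"
      by (auto intro!: always_eventually order_trans[OF _ abs_ge_self])
  qed (simp add: set_borel_measurable_def)
  have "set_integrable lborel {0..1} ?f"
    using set_integrable_kernel_unit[OF assms(2), of 1] by simp
  from set_integrable_Un[OF this tail] have "set_integrable lborel ({0..1} \<union> {1..}) ?f" by simp
  moreover have "{0..1} \<union> {1..} = {0::real..}" by auto
  ultimately show ?thesis by simp
qed

section \<open>The integral as a function of the frequency\<close>

definition kernel_integral :: "real \<Rightarrow> real \<Rightarrow> real" where
  "kernel_integral \<alpha> \<mu> = (LBINT z:{-1..1}. (1 - cos (\<mu> * z)) / \<bar>z\<bar> powr (1 + 2 * \<alpha>))"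

lemma kernel_integral_minus: "kernel_integral \<alpha> (- \<mu>) = kernel_integral \<alpha> \<mu>"
  by (simp add: kernel_integral_def)

lemma kernel_integral_nonneg: "0 \<le> kernel_integral \<alpha> \<mu>"
  unfolding kernel_integral_def set_lebesgue_integral_def
  by (rule integral_nonneg_AE) simp

lemma kernel_integral_unit:
  assumes "\<alpha> < 1"
  shows "kernel_integral \<alpha> \<mu> = 2 * (LBINT z:{0..1}. (1 - cos (\<mu> * z)) / z powr (1 + 2 * \<alpha>))"
proof -
  have "set_integrable lborel {0..1} (\<lambda>z. (1 - cos (\<mu> * z)) / \<bar>z\<bar> powr (1 + 2 * \<alpha>))"
    using set_integrable_kernel_unit[OF assms, of \<mu>]
    by (rule set_integrable_cong[THEN iffD1, rotated -1]) auto
  then have "kernel_integral \<alpha> \<mu>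
      = 2 * (LBINT z:{0..1}. (1 - cos (\<mu> * z)) / \<bar>z\<bar> powr (1 + 2 * \<alpha>))"
    unfolding kernel_integral_def by (intro set_integral_symmetric_interval_even) auto
  also have "(LBINT z:{0..1}. (1 - cos (\<mu> * z)) / \<bar>z\<bar> powr (1 + 2 * \<alpha>))
      = (LBINT z:{0..1}. (1 - cos (\<mu> * z)) / z powr (1 + 2 * \<alpha>))"
    by (intro set_lebesgue_integral_cong) auto
  finally show ?thesis .
qed

text \<open>
  Substituting \<open>\<tau> = \<mu> * z\<close>: the Jacobian contributes one power of \<open>\<mu>\<close> and the homogeneous
  denominator \<open>1 + 2 * \<alpha>\<close> of them.
\<close>
lemma kernel_integral_rescale:
  assumes "\<alpha> < 1" "0 < \<mu>"
  shows "kernel_integral \<alpha> \<mu>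
    = 2 * \<mu> powr (2 * \<alpha>) * (LBINT \<tau>:{0..\<mu>}. (1 - cos \<tau>) / \<tau> powr (1 + 2 * \<alpha>))"
proof -
  let ?f = "\<lambda>\<tau>. (1 - cos \<tau>) / \<tau> powr (1 + 2 * \<alpha>)"
  (* The substitution acts on the integrands extended by zero, hence the indicators. *)
  have pw: "\<mu> * (indicator {0..\<mu>} (0 + \<mu> * z) *\<^sub>R ?f (0 + \<mu> * z))
      = \<mu> powr (- (2 * \<alpha>)) * (indicator {0..1} z *\<^sub>R ((1 - cos (\<mu> * z)) / z powr (1 + 2 * \<alpha>)))" for z
  proof (cases "z \<in> {0..1}")
    case True
    have "\<mu> / \<mu> powr (1 + 2 * \<alpha>) = \<mu> powr (- (2 * \<alpha>))"
      using assms(2) by (simp add: powr_add powr_minus field_simps)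
    moreover have "\<mu> * ?f (\<mu> * z)
        = \<mu> / \<mu> powr (1 + 2 * \<alpha>) * ((1 - cos (\<mu> * z)) / z powr (1 + 2 * \<alpha>))"
      using assms(2) True by (simp add: powr_mult)
    moreover have "\<mu> * z \<in> {0..\<mu>}"
      using True assms(2) by (auto simp: mult_left_le)
    ultimately show ?thesis using True by simp
  next
    case False
    then have "\<mu> * z \<notin> {0..\<mu>}" using assms(2) by (auto simp: zero_le_mult_iff)
    with False show ?thesis by simp
  qed
  have "(LBINT \<tau>:{0..\<mu>}. ?f \<tau>) = \<mu> * (LBINT z. indicator {0..\<mu>} (0 + \<mu> * z) *\<^sub>R ?f (0 + \<mu> * z))"
    unfolding set_lebesgue_integral_def
    using lborel_integral_real_affine[of \<mu> "\<lambda>\<tau>. indicator {0..\<mu>} \<tau> *\<^sub>R ?f \<tau>" 0] assms(2) by simp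
  also have "\<dots> = (LBINT z. \<mu> * (indicator {0..\<mu>} (0 + \<mu> * z) *\<^sub>R ?f (0 + \<mu> * z)))"
    by (rule integral_mult_right_zero[symmetric])
  also have "\<dots> = \<mu> powr (- (2 * \<alpha>)) * (LBINT z:{0..1}. (1 - cos (\<mu> * z)) / z powr (1 + 2 * \<alpha>))"
    unfolding pw set_lebesgue_integral_def by (rule integral_mult_right_zero)
  finally show ?thesis
    using assms by (simp add: kernel_integral_unit powr_minus)
qed

text \<open>
  Dominated convergence along sequences, with \<open>(1 - cos x) / x\<^sup>2\<close> tending to \<open>1 / 2\<close> at \<open>0\<close>. The
  limit function serves as its own majorant, by \<open>kernel_le\<close>.
\<close>
lemma kernel_integral_at_0:
  assumes "\<alpha> < 1"
  shows "((\<lambda>\<mu>. kernel_integral \<alpha> \<mu> / \<mu>\<^sup>2) \<longlongrightarrow> 1 / (2 * (1 - \<alpha>))) (at 0)"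
  unfolding tendsto_at_iff_sequentially comp_def
proof (intro allI impI)
  fix X :: "nat \<Rightarrow> real"
  assume X: "\<forall>i. X i \<in> UNIV - {0}" "X \<longlonglongrightarrow> 0"
  let ?s = "\<lambda>n z. indicator {0..1} z *\<^sub>R ((1 - cos (X n * z)) / z powr (1 + 2 * \<alpha>)) / (X n)\<^sup>2"
  let ?w = "\<lambda>z. indicator {0..1} z *\<^sub>R (z powr (1 - 2 * \<alpha>)) / 2"
  have int_w: "integrable lborel ?w"
    using set_integrable_powr_unit[OF assms] unfolding set_integrable_def by simp
  have "(\<lambda>n. LBINT z. ?s n z) \<longlonglongrightarrow> (LBINT z. ?w z)"
  proof (rule integral_dominated_convergence[where w = ?w])
    show "AE z in lborel. norm (?s n z) \<le> ?w z" for n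
    proof (intro always_eventually allI)
      fix z :: real
      have "\<bar>(1 - cos (X n * z)) / z powr (1 + 2 * \<alpha>)\<bar> / (X n)\<^sup>2 \<le> z powr (1 - 2 * \<alpha>) / 2"
        if "0 \<le> z"
        using divide_right_mono[OF kernel_le[OF that, of "X n" \<alpha>], of "(X n)\<^sup>2"] X(1) by simp
      then show "norm (?s n z) \<le> ?w z"
        by (auto simp: indicator_def)
    qed
    show "AE z in lborel. (\<lambda>n. ?s n z) \<longlonglongrightarrow> ?w z"
    proof (intro always_eventually allI)
      fix z :: real
      show "(\<lambda>n. ?s n z) \<longlonglongrightarrow> ?w z"
      proof (cases "z \<in> {0<..1}")
        case True
        have lim: "((\<lambda>x::real. (1 - cos x) / x\<^sup>2) \<longlongrightarrow> 1 / 2) (at 0)"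
          by real_asymp
        have "filterlim (\<lambda>n. X n * z) (at 0) sequentially"
          unfolding filterlim_at using X True by (auto intro!: tendsto_mult_left_zero)
        from filterlim_compose[OF lim this]
        have "(\<lambda>n. (1 - cos (X n * z)) / (X n * z)\<^sup>2 * z powr (1 - 2 * \<alpha>))
            \<longlonglongrightarrow> 1 / 2 * z powr (1 - 2 * \<alpha>)"
          by (rule tendsto_mult_right)
        moreover have "(1 - cos (X n * z)) / (X n * z)\<^sup>2 * z powr (1 - 2 * \<alpha>) = ?s n z" for n
          using True square_div_powr[of z \<alpha>, symmetric]
          by (simp add: power_mult_distrib)
        ultimately show ?thesis using True by simp
      next
        case False
        (* At z = 0 both sides are 0: the divisor 0 powr _ is 0, and x / 0 = 0. *)
        then have "z = 0 \<or> z \<notin> {0..1}" by auto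
        then show ?thesis by auto
      qed
    qed
  qed (use int_w in auto)
  also have "(LBINT z. ?w z) = 1 / (2 * (1 - \<alpha>)) / 2"
    using set_integral_powr_unit[OF assms] by (simp add: set_lebesgue_integral_def)
  finally have "(\<lambda>n. 2 * (LBINT z. ?s n z)) \<longlonglongrightarrow> 2 * (1 / (2 * (1 - \<alpha>)) / 2)"
    by (rule tendsto_mult_left)
  moreover have "2 * (LBINT z. ?s n z) = kernel_integral \<alpha> (X n) / (X n)\<^sup>2" for n
    unfolding kernel_integral_unit[OF assms] set_lebesgue_integral_def integral_divide_zero by simp
  moreover have "2 * (c / 2) = c" for c :: real
    by simp
  ultimately show "(\<lambda>n. kernel_integral \<alpha> (X n) / (X n)\<^sup>2) \<longlonglongrightarrow> 1 / (2 * (1 - \<alpha>))"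
    by (simp only:)
qed

text \<open>
  After rescaling, only the convergence of the truncated integrals to the improper one is left.
\<close>
lemma kernel_integral_at_top:
  assumes "0 < \<alpha>" "\<alpha> < 1"
  shows "((\<lambda>\<mu>. kernel_integral \<alpha> \<mu> / \<mu> powr (2 * \<alpha>))
    \<longlongrightarrow> 2 * (LBINT \<tau>:{0<..}. (1 - cos \<tau>) / \<tau> powr (1 + 2 * \<alpha>))) at_top"
proof -
  let ?f = "\<lambda>\<tau>. (1 - cos \<tau>) / \<tau> powr (1 + 2 * \<alpha>)"
  (* The kernel takes the value 0 / 0 = 0 at 0, so including the end point changes nothing. *)
  have "(\<lambda>\<tau>. indicator {0..} \<tau> *\<^sub>R ?f \<tau>) = (\<lambda>\<tau>. indicator {0<..} \<tau> *\<^sub>R ?f \<tau>)"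
    by (auto simp: fun_eq_iff indicator_def)
  then have "(LBINT \<tau>:{0..}. ?f \<tau>) = (LBINT \<tau>:{0<..}. ?f \<tau>)"
    by (simp add: set_lebesgue_integral_def)
  moreover have "((\<lambda>\<mu>. LBINT \<tau>:{0..\<mu>}. ?f \<tau>) \<longlongrightarrow> (LBINT \<tau>:{0..}. ?f \<tau>)) at_top"
    using set_integrable_kernel_half_line[OF assms]
    by (intro tendsto_set_lebesgue_integral_at_top) auto
  ultimately have "((\<lambda>\<mu>. 2 * (LBINT \<tau>:{0..\<mu>}. ?f \<tau>)) \<longlongrightarrow> 2 * (LBINT \<tau>:{0<..}. ?f \<tau>)) at_top"
    by (simp add: tendsto_mult_left)
  moreover have "eventually (\<lambda>\<mu>. 2 * (LBINT \<tau>:{0..\<mu>}. ?f \<tau>)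
      = kernel_integral \<alpha> \<mu> / \<mu> powr (2 * \<alpha>)) at_top"
    using eventually_gt_at_top[of 0]
    by eventually_elim (simp add: kernel_integral_rescale[OF assms(2)])
  ultimately show ?thesis by (rule Lim_transform_eventually)
qed

section \<open>Asymptotics of the dispersion relation\<close>

lemma omega_squared:
  assumes "0 < \<rho>" "0 < \<kappa>"
  shows "(omega \<rho> \<kappa> \<delta> \<alpha> \<xi>)\<^sup>2 = 2 * \<kappa> / (\<rho> * \<delta> powr (2 * \<alpha>)) * kernel_integral \<alpha> (\<xi> * \<delta>)"
  using assms kernel_integral_nonneg[of \<alpha> "\<xi> * \<delta>"]
  unfolding omega_def kernel_integral_def by (intro real_sqrt_pow2 mult_nonneg_nonneg) auto

theorem theorem2p1:
  fixes \<rho> \<kappa> \<delta> \<alpha> :: real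
  assumes "\<rho> > 0" and "\<kappa> > 0" and "\<delta> > 0" and "0 < \<alpha>" and "\<alpha> < 1"
  shows "((\<lambda>\<xi>. \<xi> powi (-2) * (omega \<rho> \<kappa> \<delta> \<alpha> \<xi>)\<^sup>2)
            \<longlongrightarrow> \<kappa> * \<delta> powr (2 * (1 - \<alpha>)) / ((1 - \<alpha>) * \<rho>)) (at 0)
       \<and> ((\<lambda>\<xi>. \<bar>\<xi>\<bar> powr (- 2 * \<alpha>) * (omega \<rho> \<kappa> \<delta> \<alpha> \<xi>)\<^sup>2)
            \<longlongrightarrow> 4 * \<kappa> / \<rho> * (LBINT \<tau>:{0<..}. (1 - cos \<tau>) / \<tau> powr (1 + 2 * \<alpha>))) at_top
       \<and> ((\<lambda>\<xi>. \<bar>\<xi>\<bar> powr (- 2 * \<alpha>) * (omega \<rho> \<kappa> \<delta> \<alpha> \<xi>)\<^sup>2)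
            \<longlongrightarrow> 4 * \<kappa> / \<rho> * (LBINT \<tau>:{0<..}. (1 - cos \<tau>) / \<tau> powr (1 + 2 * \<alpha>))) at_bot"
proof (intro conjI)
  let ?L = "LBINT \<tau>:{0<..}. (1 - cos \<tau>) / \<tau> powr (1 + 2 * \<alpha>)"
  let ?h = "\<lambda>\<xi>. \<bar>\<xi>\<bar> powr (- 2 * \<alpha>) * (omega \<rho> \<kappa> \<delta> \<alpha> \<xi>)\<^sup>2"
  note om = omega_squared[OF assms(1,2), of \<delta> \<alpha>]
  show "((\<lambda>\<xi>. \<xi> powi (-2) * (omega \<rho> \<kappa> \<delta> \<alpha> \<xi>)\<^sup>2)
      \<longlongrightarrow> \<kappa> * \<delta> powr (2 * (1 - \<alpha>)) / ((1 - \<alpha>) * \<rho>)) (at 0)"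
  proof -
    (* The factor of omega_squared times \<delta>\<^sup>2, since the limit is taken in \<xi> * \<delta>. *)
    let ?c = "2 * \<kappa> * \<delta> powr (2 * (1 - \<alpha>)) / \<rho>"
    have powr: "\<delta> powr (2 * (1 - \<alpha>)) = \<delta>\<^sup>2 / \<delta> powr (2 * \<alpha>)"
      using assms(3) by (simp add: right_diff_distrib powr_diff)
    have "filterlim (\<lambda>\<xi>. \<xi> * \<delta>) (at 0) (at 0)"
      using assms(3) unfolding filterlim_at
      by (auto simp: eventually_at_filter intro!: tendsto_mult_left_zero tendsto_ident_at)
    from filterlim_compose[OF kernel_integral_at_0[OF assms(5)] this]
    have "((\<lambda>\<xi>. ?c * (kernel_integral \<alpha> (\<xi> * \<delta>) / (\<xi> * \<delta>)\<^sup>2)) \<longlongrightarrow> ?c * (1 / (2 * (1 - \<alpha>)))) (at 0)"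
      by (rule tendsto_mult_left)
    moreover have "?c * (kernel_integral \<alpha> (\<xi> * \<delta>) / (\<xi> * \<delta>)\<^sup>2)
        = \<xi> powi (-2) * (omega \<rho> \<kappa> \<delta> \<alpha> \<xi>)\<^sup>2" for \<xi>
      using assms(1,3) unfolding om powr
      by (simp add: power_int_minus power_mult_distrib divide_simps)
    moreover have "2 * \<kappa> * d / \<rho> * (1 / (2 * b)) = \<kappa> * d / (b * \<rho>)" for b d
      by simp
    ultimately show ?thesis by (simp only:)
  qed
  show top: "(?h \<longlongrightarrow> 4 * \<kappa> / \<rho> * ?L) at_top"
  proof -
    have "filterlim (\<lambda>\<xi>. \<xi> * \<delta>) at_top at_top"
      using assms(3) by real_asymp
    from filterlim_compose[OF kernel_integral_at_top[OF assms(4,5)] this]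
    have "((\<lambda>\<xi>. 2 * \<kappa> / \<rho> * (kernel_integral \<alpha> (\<xi> * \<delta>) / (\<xi> * \<delta>) powr (2 * \<alpha>)))
        \<longlongrightarrow> 2 * \<kappa> / \<rho> * (2 * ?L)) at_top"
      by (rule tendsto_mult_left)
    moreover have "eventually (\<lambda>\<xi>. 2 * \<kappa> / \<rho> * (kernel_integral \<alpha> (\<xi> * \<delta>) / (\<xi> * \<delta>) powr (2 * \<alpha>))
        = ?h \<xi>) at_top"
      using eventually_gt_at_top[of 0]
      by eventually_elim (use assms(3) in \<open>simp add: om powr_mult powr_minus field_simps\<close>)
    ultimately have "(?h \<longlongrightarrow> 2 * \<kappa> / \<rho> * (2 * ?L)) at_top"
      by (rule Lim_transform_eventually)
    moreover have "2 * \<kappa> / \<rho> * (2 * L) = 4 * \<kappa> / \<rho> * L" for L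
      by simp
    ultimately show ?thesis by (simp only:)
  qed
  have "?h (- \<xi>) = ?h \<xi>" for \<xi>
    using kernel_integral_minus[of \<alpha> "\<xi> * \<delta>"] by (simp add: om)
  with top show "(?h \<longlongrightarrow> 4 * \<kappa> / \<rho> * ?L) at_bot"
    unfolding filterlim_at_bot_mirror by (simp only:)
qed

end
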